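(* Let $L>3$, let $S\subseteq\mathbb{S}_L$ be a dense subset, and let $a_0,\ldots,a_{n_L}=a_0$ be an orienting loop in $S$. Then the structure $S_L:=(S,B(-,-),(a_i)_{i\le n_L})$ (with one binary relation $B$, where $B(x,y)$ holds iff $d_L(x,y)<1$, and constants for the $a_i$) defines the ternary relations $\{C_{z,t,k}: z,t,k\in\mathbb{Z}\}$ on $S$ and the partial functions $f_z: a\mapsto a+z$ on $S$ (defined at those $a\in S$ with $a+z\in S$), for all $z\in\mathbb{Z}$.
   Context: For real $L\ge2$, the circle of length $L$ is the quotient group $\mathbb{S}_L=(\mathbb{R}/L\mathbb{Z},+_L)$; for $x\in\mathbb{R}$ write $[x]=x+L\mathbb{Z}$, and for $a\in \mathbb{S}_L$, $z\in\mathbb{Z}$ write $a+z$ for $a+_L[z]$. It carries the metric $d_L(a,b)=\min\{|x-y|,L-|x-y|\}$, where $x,y\in[0,L)$ are the unique elements with $[x]=a,[y]=b$. The circular order $C(a,b,c)$ on $\mathbb{S}_L$ holds iff $x<y<z$ or $y<z<x$ or $z<x<y$, where $x,y,z\in[0,L)$ are such that $[x]=a,[y]=b,[z]=c$. For $z,t,k\in\mathbb{Z}$ and $a,b,c\in S$, $C_{z,t,k}(a,b,c)$ holds iff $C(a+z,b+t,c+k)$. For $a,b\in\mathbb{S}_L$, $I(a,b)$ denotes the shorter arc (including end points) in $\mathbb{S}_L$ between $a$ and $b$. For $L>3$ put $n_L:=\lfloor L\rfloor+1$. A sequence $a_0,\ldots,a_{n_L}=a_0$ in $\mathbb{S}_L$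 is an orienting loop if $0<d_L(a_i,a_{i+1})<1$ and $C(a_i,a_{i+1},a_{i+2})$ for all $i$ (indices modulo $n_L$), and $\{I(a_i,a_{i+1})\setminus\{a_i,a_{i+1}\}: i<n_L\}$ forms a partition of $\mathbb{S}_L\setminus\{a_0,\ldots,a_{n_L-1}\}$. *)

theory Defs
  imports Complex_Main "HOL-Algebra.Coset" "HOL-Library.Disjoint_Sets"
begin

section \<open>The circle of length L\<close>

definition real_group :: "real monoid" where
  "real_group = \<lparr>carrier = UNIV, monoid.mult = (+), one = 0\<rparr>"

definition periods :: "real \<Rightarrow> real set" where
  "periods L = range (\<lambda>k::int. of_int k * L)"

definition circle :: "real \<Rightarrow> real set monoid" where
  "circle L = real_group Mod periods L"

definition cls :: "real \<Rightarrow> real \<Rightarrow> real set" where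
  "cls L x = periods L #>\<^bsub>real_group\<^esub> x"

definition shift :: "real \<Rightarrow> real set \<Rightarrow> int \<Rightarrow> real set" where
  "shift L a z = a \<otimes>\<^bsub>circle L\<^esub> cls L (of_int z)"

definition rep :: "real \<Rightarrow> real set \<Rightarrow> real" where
  "rep L a = (THE x. 0 \<le> x \<and> x < L \<and> cls L x = a)"

lemma mem_cls: "y \<in> cls L x \<longleftrightarrow> (\<exists>k::int. y = of_int k * L + x)"
  by (auto simp: cls_def periods_def r_coset_def real_group_def)

lemma carrier_circle: "carrier (circle L) = range (cls L)"
  by (auto simp: circle_def FactGroup_def RCOSETS_def cls_def real_group_def)

lemma comm_group_real_group: "comm_group real_group"
proof (rule comm_groupI)
  fix x assume "x \<in> carrier real_group"
  then show "\<exists>y\<in>carrier real_group. y \<otimes>\<^bsub>real_group\<^esub> x = \<one>\<^bsub>real_group\<^esub>"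
    by (auto simp: real_group_def intro: exI[of _ "- x"])
qed (auto simp: real_group_def)

lemma subgroup_periods: "subgroup (periods L) real_group"
proof -
  interpret comm_group real_group by (rule comm_group_real_group)
  have inv: "inv\<^bsub>real_group\<^esub> x = - x" for x
    by (rule inv_equality) (auto simp: real_group_def)
  show ?thesis
  proof (rule subgroupI)
    fix x assume "x \<in> periods L"
    then obtain k :: int where "x = of_int k * L" by (auto simp: periods_def)
    then have "- x = of_int (- k) * L" by simp
    then show "inv\<^bsub>real_group\<^esub> x \<in> periods L" unfolding inv periods_def by blast
  next
    fix x y assume "x \<in> periods L" "y \<in> periods L"
    then obtain k l :: int where "x = of_int k * L" "y = of_int l * L"
      by (auto simp: periods_def)
    then have "x + y = of_int (k + l) * L" by (simp add: algebra_simps)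
    then have "x + y \<in> periods L" unfolding periods_def by (rule range_eqI)
    then show "x \<otimes>\<^bsub>real_group\<^esub> y \<in> periods L" by (simp add: real_group_def)
  qed (auto simp: real_group_def periods_def)
qed

lemma comm_group_circle: "comm_group (circle L)"
  unfolding circle_def
  by (rule comm_group.abelian_FactGroup[OF comm_group_real_group subgroup_periods])

lemma cls_eq_iff: "cls L x = cls L y \<longleftrightarrow> (\<exists>k::int. y = of_int k * L + x)"
proof
  assume "cls L x = cls L y"
  moreover have "y \<in> cls L y" unfolding mem_cls by (intro exI[of _ 0]) simp
  ultimately show "\<exists>k::int. y = of_int k * L + x" by (simp add: mem_cls[symmetric])
next
  assume "\<exists>k::int. y = of_int k * L + x"
  then obtain k :: int where k: "y = of_int k * L + x" by blast
  have "w \<in> cls L y \<longleftrightarrow> w \<in> cls L x" for w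
  proof
    assume "w \<in> cls L y"
    then obtain l :: int where "w = of_int l * L + y" by (auto simp: mem_cls)
    then have "w = of_int (l + k) * L + x" by (simp add: k algebra_simps)
    then show "w \<in> cls L x" unfolding mem_cls by blast
  next
    assume "w \<in> cls L x"
    then obtain l :: int where "w = of_int l * L + x" by (auto simp: mem_cls)
    then have "w = of_int (l - k) * L + y" by (simp add: k algebra_simps)
    then show "w \<in> cls L y" unfolding mem_cls by blast
  qed
  then show "cls L x = cls L y" by blast
qed

lemma ex1_rep:
  assumes "L > 0" "a \<in> carrier (circle L)"
  shows "\<exists>!x. 0 \<le> x \<and> x < L \<and> cls L x = a"
proof -
  obtain y where y: "a = cls L y" using assms(2) by (auto simp: carrier_circle)
  define k where "k = \<lfloor>y / L\<rfloor>"
  have "of_int k \<le> y / L" "y / L < of_int k + 1" by (simp_all add: k_def)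
  then have "0 \<le> y - of_int k * L" "y - of_int k * L < L"
    using assms(1) by (simp_all add: field_simps)
  moreover have "cls L (y - of_int k * L) = a"
    unfolding y cls_eq_iff by (intro exI[of _ k]) simp
  moreover have "x = x'" if "0 \<le> x" "x < L" "cls L x = a" "0 \<le> x'" "x' < L" "cls L x' = a" for x x'
  proof -
    have "cls L x = cls L x'" using that by simp
    then obtain m :: int where m: "x' = of_int m * L + x" unfolding cls_eq_iff by blast
    then have "of_int m * L < 1 * L" "(-1) * L < of_int m * L" using that by linarith+
    then have "of_int m < (1::real)" "(-1::real) < of_int m"
      using assms(1) by (simp_all only: mult_less_cancel_right_pos)
    then have "m = 0" by linarith
    then show ?thesis using m by simp
  qed
  ultimately show ?thesis by blast
qed

definition circle_dist :: "real \<Rightarrow> real set \<Rightarrow> real set \<Rightarrow> real" where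
  "circle_dist L a b = min \<bar>rep L a - rep L b\<bar> (L - \<bar>rep L a - rep L b\<bar>)"

definition circ_order :: "real \<Rightarrow> real set \<Rightarrow> real set \<Rightarrow> real set \<Rightarrow> bool" where
  "circ_order L a b c \<longleftrightarrow>
     (let x = rep L a; y = rep L b; z = rep L c
      in x < y \<and> y < z \<or> y < z \<and> z < x \<or> z < x \<and> x < y)"

definition circ_order_shift ::
    "real \<Rightarrow> int \<Rightarrow> int \<Rightarrow> int \<Rightarrow> real set \<Rightarrow> real set \<Rightarrow> real set \<Rightarrow> bool" where
  "circ_order_shift L z t k a b c \<longleftrightarrow> circ_order L (shift L a z) (shift L b t) (shift L c k)"

definition dense_in_circle :: "real \<Rightarrow> real set set \<Rightarrow> bool" where
  "dense_in_circle L S \<longleftrightarrow> S \<subseteq> carrier (circle L) \<and>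
     (\<forall>a \<in> carrier (circle L). \<forall>e>0. \<exists>s\<in>S. circle_dist L a s < e)"

section \<open>Arcs and orienting loops\<close>

text \<open>The closed arc travelled from \<open>a\<close> to \<open>b\<close> in the positive direction, and its length.\<close>

definition pos_arc :: "real \<Rightarrow> real set \<Rightarrow> real set \<Rightarrow> real set set" where
  "pos_arc L a b = {a, b} \<union> {c \<in> carrier (circle L). circ_order L a c b}"

definition pos_arc_length :: "real \<Rightarrow> real set \<Rightarrow> real set \<Rightarrow> real" where
  "pos_arc_length L a b =
     (if rep L a \<le> rep L b then rep L b - rep L a else L - (rep L a - rep L b))"

text \<open>For antipodal points both arcs have length \<open>L / 2\<close> and the choice below is arbitrary;
  orienting loops only use arcs between points at distance less than 1.\<close>

definition short_arc :: "real \<Rightarrow> real set \<Rightarrow> real set \<Rightarrow> real set set" where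
  "short_arc L a b =
     (if pos_arc_length L a b \<le> pos_arc_length L b a then pos_arc L a b else pos_arc L b a)"

definition nL :: "real \<Rightarrow> nat" where
  "nL L = nat \<lfloor>L\<rfloor> + 1"

text \<open>Only the values \<open>a 0, \<dots>, a (nL L)\<close> matter.\<close>

definition orienting_loop :: "real \<Rightarrow> (nat \<Rightarrow> real set) \<Rightarrow> bool" where
  "orienting_loop L a \<longleftrightarrow>
     (\<forall>i \<le> nL L. a i \<in> carrier (circle L)) \<and>
     a (nL L) = a 0 \<and>
     (\<forall>i < nL L. 0 < circle_dist L (a i) (a (i + 1)) \<and> circle_dist L (a i) (a (i + 1)) < 1 \<and>
        circ_order L (a i) (a (i + 1)) (a ((i + 2) mod nL L))) \<and>
     partition_on (carrier (circle L) - a ` {..<nL L})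
       ((\<lambda>i. short_arc L (a i) (a (i + 1)) - {a i, a (i + 1)}) ` {..<nL L})"

section \<open>First-order definability with one binary relation and constants\<close>

datatype fo_term = Var nat | Const nat

datatype fo_form =
    Eq fo_term fo_term
  | Rel fo_term fo_term
  | Neg fo_form
  | Conj fo_form fo_form
  | Exi nat fo_form

text \<open>\<open>csyms\<close> is the set of constant symbols of the language of the structure; \<open>const\<close> is
  meaningful on \<open>csyms\<close> only.\<close>

record 'a struct =
  univ :: "'a set"
  brel :: "'a \<Rightarrow> 'a \<Rightarrow> bool"
  csyms :: "nat set"
  const :: "nat \<Rightarrow> 'a"

primrec fv_term :: "fo_term \<Rightarrow> nat set" where
  "fv_term (Var n) = {n}"
| "fv_term (Const c) = {}"

primrec fv :: "fo_form \<Rightarrow> nat set" where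
  "fv (Eq s t) = fv_term s \<union> fv_term t"
| "fv (Rel s t) = fv_term s \<union> fv_term t"
| "fv (Neg p) = fv p"
| "fv (Conj p q) = fv p \<union> fv q"
| "fv (Exi n p) = fv p - {n}"

primrec consts_term :: "fo_term \<Rightarrow> nat set" where
  "consts_term (Var n) = {}"
| "consts_term (Const c) = {c}"

primrec consts_form :: "fo_form \<Rightarrow> nat set" where
  "consts_form (Eq s t) = consts_term s \<union> consts_term t"
| "consts_form (Rel s t) = consts_term s \<union> consts_term t"
| "consts_form (Neg p) = consts_form p"
| "consts_form (Conj p q) = consts_form p \<union> consts_form q"
| "consts_form (Exi n p) = consts_form p"

primrec val :: "'a struct \<Rightarrow> (nat \<Rightarrow> 'a) \<Rightarrow> fo_term \<Rightarrow> 'a" where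
  "val M e (Var n) = e n"
| "val M e (Const c) = const M c"

primrec sat :: "'a struct \<Rightarrow> (nat \<Rightarrow> 'a) \<Rightarrow> fo_form \<Rightarrow> bool" where
  "sat M e (Eq s t) \<longleftrightarrow> val M e s = val M e t"
| "sat M e (Rel s t) \<longleftrightarrow> brel M (val M e s) (val M e t)"
| "sat M e (Neg p) \<longleftrightarrow> \<not> sat M e p"
| "sat M e (Conj p q) \<longleftrightarrow> sat M e p \<and> sat M e q"
| "sat M e (Exi n p) \<longleftrightarrow> (\<exists>x \<in> univ M. sat M (e(n := x)) p)"

text \<open>Definability without parameters. Tuples are lists; the variable \<open>Var i\<close> denotes the entry
  with index \<open>i\<close>, and the values of \<open>(!) xs\<close> beyond the length of \<open>xs\<close> are irrelevant because of
  the restriction on free variables.\<close>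

definition definable :: "'a struct \<Rightarrow> nat \<Rightarrow> 'a list set \<Rightarrow> bool" where
  "definable M m R \<longleftrightarrow>
     (\<exists>p. fv p \<subseteq> {..<m} \<and> consts_form p \<subseteq> csyms M \<and>
        R = {xs. length xs = m \<and> set xs \<subseteq> univ M \<and> sat M ((!) xs) p})"

text \<open>A partial function is definable iff its graph is.\<close>

definition definable_pfun :: "'a struct \<Rightarrow> ('a \<rightharpoonup> 'a) \<Rightarrow> bool" where
  "definable_pfun M f \<longleftrightarrow> definable M 2 {[x, y] | x y. f x = Some y}"

section \<open>The structure on a dense subset of the circle\<close>

definition SL :: "real \<Rightarrow> real set set \<Rightarrow> (nat \<Rightarrow> real set) \<Rightarrow> real set struct" where
  "SL L S a =
     \<lparr>univ = S, brel = (\<lambda>x y. circle_dist L x y < 1), csyms = {..nL L}, const = a\<rparr>"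

definition C_rel :: "real \<Rightarrow> real set set \<Rightarrow> int \<Rightarrow> int \<Rightarrow> int \<Rightarrow> real set list set" where
  "C_rel L S z t k =
     {[x, y, w] | x y w. x \<in> S \<and> y \<in> S \<and> w \<in> S \<and> circ_order_shift L z t k x y w}"

definition shift_pfun :: "real \<Rightarrow> real set set \<Rightarrow> int \<Rightarrow> (real set \<rightharpoonup> real set)" where
  "shift_pfun L S z = (\<lambda>x. if x \<in> S \<and> shift L x z \<in> S then Some (shift L x z) else None)"

end

theory Submission
  imports Defs
begin

text \<open>Since \<open>nL L \<le> L + 1\<close> and the steps of an orienting loop have length less than 1, the loop winds
  around the circle exactly once. The closed arc from \<open>a i\<close> to \<open>a (i + 1)\<close> consists of the points
  all of whose neighbours with respect to \<open>B\<close> are neighbours of \<open>a i\<close> or of \<open>a (i + 1)\<close>, and for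
  points \<open>x\<close>, \<open>y\<close> of this arc, \<open>x\<close> precedes \<open>y\<close> iff some neighbour of \<open>x\<close> is a neighbour neither
  of \<open>y\<close> nor of \<open>a (i + 1)\<close>. Hence the linear order of the coordinates \<open>c x \<in> [0, L)\<close> measured
  from \<open>a 0\<close> is definable. Together with \<open>B\<close> it defines \<open>c x \<plusminus> 1 < c y + m L\<close>, and
  since \<open>S\<close> is dense, strict inequalities can be chained, which gives \<open>c x + z < c y + m L\<close> for all
  integers \<open>z\<close>, \<open>m\<close>. The relations \<open>C\<^bsub>z,t,k\<^esub>\<close> and the graphs of \<open>f\<^sub>z\<close> are Boolean combinations of
  finitely many of these.\<close>

section \<open>Real lifts of points of the circle\<close>

lemma rep_props:
  assumes "L > 0" "x \<in> carrier (circle L)"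
  shows "0 \<le> rep L x" "rep L x < L" "cls L (rep L x) = x"
  using theI'[OF ex1_rep[OF assms]] by (auto simp: rep_def)

lemma cls_in_carrier [simp]: "cls L u \<in> carrier (circle L)"
  by (simp add: carrier_circle)

lemma shift_cls: "shift L (cls L u) z = cls L (u + of_int z)"
proof -
  have "w \<in> shift L (cls L u) z \<longleftrightarrow> w \<in> cls L (u + of_int z)" for w
  proof
    assume "w \<in> shift L (cls L u) z"
    then obtain k l :: int where "w = (of_int k * L + u) + (of_int l * L + of_int z)"
      by (auto simp: shift_def circle_def FactGroup_def set_mult_def real_group_def mem_cls)
    then have "w = of_int (k + l) * L + (u + of_int z)"
      by (simp add: algebra_simps)
    then show "w \<in> cls L (u + of_int z)"
      unfolding mem_cls by blast
  next
    assume "w \<in> cls L (u + of_int z)"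
    then obtain k :: int where k: "w = of_int k * L + (u + of_int z)"
      by (auto simp: mem_cls)
    have "of_int k * L + u \<in> cls L u" "of_int z \<in> cls L (of_int z)"
      by (auto simp: mem_cls intro: exI[of _ 0])
    moreover have "w = (of_int k * L + u) + of_int z"
      by (simp add: k)
    ultimately show "w \<in> shift L (cls L u) z"
      unfolding shift_def circle_def FactGroup_def set_mult_def real_group_def by auto
  qed
  then show ?thesis by blast
qed

text \<open>The left side bounds the distance from u to any multiple of L: 0 is at distance |u|,
  every other multiple at distance at least L - |u|.\<close>

lemma abs_add_multiple_ge:
  fixes L u :: real and k :: int
  assumes "L > 0" "\<bar>u\<bar> < L"
  shows "min \<bar>u\<bar> (L - \<bar>u\<bar>) \<le> \<bar>u + of_int k * L\<bar>"
proof (cases "k = 0")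
  case False
  then consider "k \<ge> 1" | "k \<le> -1" by linarith
  then show ?thesis
  proof cases
    case 1
    then have "1 * L \<le> of_int k * L"
      using assms by (intro mult_right_mono) auto
    then show ?thesis using assms by linarith
  next
    case 2
    then have "of_int k * L \<le> (-1) * L"
      using assms by (intro mult_right_mono) auto
    then show ?thesis using assms by linarith
  qed
qed auto

text \<open>Frees distance estimates from the representatives in [0, L): passing to other lifts only
  renumbers the integer k.\<close>

lemma circle_dist_less_iff:
  assumes "L > 0"
  shows "circle_dist L (cls L u) (cls L v) < e \<longleftrightarrow> (\<exists>k::int. \<bar>u - v + of_int k * L\<bar> < e)"
proof -
  define r s where "r = rep L (cls L u)" and "s = rep L (cls L v)"
  have r: "0 \<le> r" "r < L" "cls L r = cls L u" and s: "0 \<le> s" "s < L" "cls L s = cls L v"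
    unfolding r_def s_def using rep_props[OF assms] by auto
  obtain i j :: int where i: "u = of_int i * L + r" and j: "v = of_int j * L + s"
    using r(3) s(3) unfolding cls_eq_iff by blast
  have "min \<bar>r - s\<bar> (L - \<bar>r - s\<bar>) < e \<longleftrightarrow> (\<exists>k::int. \<bar>r - s + of_int k * L\<bar> < e)"
  proof
    assume "min \<bar>r - s\<bar> (L - \<bar>r - s\<bar>) < e"
    then have "\<bar>r - s + of_int 0 * L\<bar> < e \<or> \<bar>r - s + of_int 1 * L\<bar> < e
        \<or> \<bar>r - s + of_int (-1) * L\<bar> < e"
      using r s by (auto simp: min_def abs_if split: if_splits)
    then show "\<exists>k::int. \<bar>r - s + of_int k * L\<bar> < e" by blast
  next
    assume "\<exists>k::int. \<bar>r - s + of_int k * L\<bar> < e"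
    then obtain k :: int where "\<bar>r - s + of_int k * L\<bar> < e" by blast
    moreover have "\<bar>r - s\<bar> < L" using r s by linarith
    ultimately show "min \<bar>r - s\<bar> (L - \<bar>r - s\<bar>) < e"
      using abs_add_multiple_ge[OF assms, of "r - s" k] by linarith
  qed
  also have "\<dots> \<longleftrightarrow> (\<exists>k::int. \<bar>u - v + of_int k * L\<bar> < e)"
  proof
    assume "\<exists>k::int. \<bar>r - s + of_int k * L\<bar> < e"
    then obtain k :: int where "\<bar>r - s + of_int k * L\<bar> < e" by blast
    then have "\<bar>u - v + of_int (k - i + j) * L\<bar> < e"
      by (simp add: i j algebra_simps)
    then show "\<exists>k::int. \<bar>u - v + of_int k * L\<bar> < e" by blast
  next
    assume "\<exists>k::int. \<bar>u - v + of_int k * L\<bar> < e"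
    then obtain k :: int where "\<bar>u - v + of_int k * L\<bar> < e" by blast
    then have "\<bar>r - s + of_int (k + i - j) * L\<bar> < e"
      by (simp add: i j algebra_simps)
    then show "\<exists>k::int. \<bar>r - s + of_int k * L\<bar> < e" by blast
  qed
  finally show ?thesis
    by (simp add: circle_dist_def r_def s_def)
qed

lemma int_multiple_bounds:
  fixes L :: real and k :: int
  assumes "L > 0" "of_int i * L < of_int k * L" "of_int k * L < of_int j * L"
  shows "i < k" "k < j"
  using assms by (simp_all add: mult_less_cancel_right_pos)

text \<open>Cyclic order means that lifts of y and w are met in this order while running through one
  period from x. Since arbitrary lifts are allowed, integer shifts can later be inserted
  directly.\<close>

lemma circ_order_cls_iff:
  assumes "L > 0"
  shows "circ_order L (cls L x) (cls L y) (cls L w) \<longleftrightarrow>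
    (\<exists>p q :: int. x < y + of_int p * L \<and> y + of_int p * L < w + of_int q * L \<and> w + of_int q * L < x + L)"
    (is "_ \<longleftrightarrow> (\<exists>p q. ?P x y w p q)")
proof -
  define r s t where "r = rep L (cls L x)" and "s = rep L (cls L y)" and "t = rep L (cls L w)"
  have r: "0 \<le> r" "r < L" "cls L r = cls L x" and s: "0 \<le> s" "s < L" "cls L s = cls L y"
    and t: "0 \<le> t" "t < L" "cls L t = cls L w"
    unfolding r_def s_def t_def using rep_props[OF assms] by auto
  obtain i j l :: int where i: "x = of_int i * L + r" and j: "y = of_int j * L + s"
    and l: "w = of_int l * L + t"
    using r(3) s(3) t(3) unfolding cls_eq_iff by blast
  have "r < s \<and> s < t \<or> s < t \<and> t < r \<or> t < r \<and> r < s \<longleftrightarrow> (\<exists>p q. ?P r s t p q)"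
  proof
    assume "r < s \<and> s < t \<or> s < t \<and> t < r \<or> t < r \<and> r < s"
    \<comment> \<open>The three disjuncts correspond, in this order, to (p, q) = (0, 0), (1, 1) and
      (0, 1): a representative smaller than r is moved up by one period.\<close>
    then have "?P r s t 0 0 \<or> ?P r s t 1 1 \<or> ?P r s t 0 1"
      using r s t by auto
    then show "\<exists>p q. ?P r s t p q" by blast
  next
    assume "\<exists>p q. ?P r s t p q"
    then obtain p q :: int where P: "?P r s t p q" by blast
    then have "of_int (-1) * L < of_int p * L" "of_int p * L < of_int 2 * L"
      "of_int (-1) * L < of_int q * L" "of_int q * L < of_int 2 * L"
      using r s t by linarith+
    note * = int_multiple_bounds[OF assms this(1,2)] int_multiple_bounds[OF assms this(3,4)]
    then have "p = 0 \<or> p = 1" "q = 0 \<or> q = 1" by linarith+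
    then show "r < s \<and> s < t \<or> s < t \<and> t < r \<or> t < r \<and> r < s"
      using P r s t by auto
  qed
  also have "\<dots> \<longleftrightarrow> (\<exists>p q. ?P x y w p q)"
  proof
    assume "\<exists>p q. ?P r s t p q"
    then obtain p q :: int where "?P r s t p q" by blast
    then have "?P x y w (p + i - j) (q + i - l)"
      by (simp add: i j l algebra_simps)
    then show "\<exists>p q. ?P x y w p q" by blast
  next
    assume "\<exists>p q. ?P x y w p q"
    then obtain p q :: int where "?P x y w p q" by blast
    then have "?P r s t (p - i + j) (q - i + l)"
      by (simp add: i j l algebra_simps)
    then show "\<exists>p q. ?P r s t p q" by blast
  qed
  finally show ?thesis
    by (simp add: circ_order_def Let_def r_def s_def t_def)
qed

section \<open>Orientation and winding number of a loop\<close>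

lemma circ_order_rotate: "circ_order L x y w \<Longrightarrow> circ_order L y w x"
  by (auto simp: circ_order_def Let_def)

lemma circ_order_distinct: "circ_order L x y w \<Longrightarrow> x \<noteq> y \<and> y \<noteq> w \<and> x \<noteq> w"
  by (auto simp: circ_order_def Let_def)

lemma cls_pos_arc_length:
  assumes "L > 0" "x \<in> carrier (circle L)" "y \<in> carrier (circle L)"
    and "cls L u = x"
  shows "cls L (u + pos_arc_length L x y) = y"
proof -
  have "cls L (rep L x) = cls L u"
    using rep_props[OF assms(1,2)] assms(4) by simp
  then obtain k :: int where k: "u = of_int k * L + rep L x"
    unfolding cls_eq_iff by blast
  have "\<exists>j::int. u + pos_arc_length L x y = of_int j * L + rep L y"
  proof (cases "rep L x \<le> rep L y")
    case True
    then show ?thesis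
      by (intro exI[of _ k]) (simp add: pos_arc_length_def k)
  next
    case False
    then show ?thesis
      \<comment> \<open>The positive arc reaches or crosses the point [0], hence one more
        period.\<close>
      by (intro exI[of _ "k + 1"]) (simp add: pos_arc_length_def k algebra_simps)
  qed
  then have "cls L (rep L y) = cls L (u + pos_arc_length L x y)"
    unfolding cls_eq_iff .
  then show ?thesis
    using rep_props[OF assms(1,3)] by simp
qed

lemma circle_dist_pos_arc_length:
  assumes "x \<noteq> y" "L > 0" "x \<in> carrier (circle L)" "y \<in> carrier (circle L)"
  shows "circle_dist L x y = min (pos_arc_length L x y) (pos_arc_length L y x)"
proof -
  have "rep L x \<noteq> rep L y"
    using assms rep_props(3) by metis
  then show ?thesis
    by (auto simp: circle_dist_def pos_arc_length_def min_def)
qed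

text \<open>If the short arc ran backwards, the circular order would put
  \<open>a ((i + 2) mod nL L)\<close> into its interior, but the members of the partition contain no
  loop point.\<close>

lemma orienting_loop_step:
  assumes "L > 0" "orienting_loop L a" "i < nL L"
  shows "0 < pos_arc_length L (a i) (a (Suc i))" "pos_arc_length L (a i) (a (Suc i)) < 1"
proof -
  let ?x = "a i" and ?y = "a (Suc i)" and ?w = "a ((i + 2) mod nL L)"
  have car: "?x \<in> carrier (circle L)" "?y \<in> carrier (circle L)" "?w \<in> carrier (circle L)"
    and d: "0 < circle_dist L ?x ?y" "circle_dist L ?x ?y < 1"
    and C: "circ_order L ?x ?y ?w"
    and part: "partition_on (carrier (circle L) - a ` {..<nL L})
       ((\<lambda>i. short_arc L (a i) (a (i + 1)) - {a i, a (i + 1)}) ` {..<nL L})"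
    using assms by (auto simp: orienting_loop_def nL_def intro!: less_imp_le)
  note ne = circ_order_distinct[OF C]
  have dist: "circle_dist L ?x ?y = min (pos_arc_length L ?x ?y) (pos_arc_length L ?y ?x)"
    using ne car assms(1) by (intro circle_dist_pos_arc_length) auto
  have "pos_arc_length L ?x ?y \<le> pos_arc_length L ?y ?x"
  proof (rule ccontr)
    assume "\<not> ?thesis"
    then have "short_arc L ?x ?y = pos_arc L ?y ?x"
      by (simp add: short_arc_def)
    then have "?w \<in> short_arc L ?x ?y - {?x, ?y}"
      using ne car circ_order_rotate[OF C] by (auto simp: pos_arc_def)
    then have "?w \<in> \<Union>((\<lambda>i. short_arc L (a i) (a (i + 1)) - {a i, a (i + 1)}) ` {..<nL L})"
      using assms(3) by (intro UN_I[of i]) simp_all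
    then have "?w \<notin> a ` {..<nL L}"
      unfolding partition_onD1[OF part, symmetric] by simp
    moreover have "?w \<in> a ` {..<nL L}"
      using assms(3) by auto
    ultimately show False by simp
  qed
  then show "0 < pos_arc_length L ?x ?y" "pos_arc_length L ?x ?y < 1"
    using d dist by auto
qed

text \<open>Partial sums of the positive arc lengths lift the loop. As the loop closes, the total is
  a multiple of L; it is positive and at most \<open>nL L\<close> \<le> L + 1 < 2 L, hence equal to
  L.\<close>

lemma orienting_loop_lift:
  assumes "L > 3" "orienting_loop L a"
  obtains \<alpha> where "\<And>i. i \<le> nL L \<Longrightarrow> cls L (\<alpha> i) = a i"
    and "\<And>i. i < nL L \<Longrightarrow> \<alpha> i < \<alpha> (Suc i) \<and> \<alpha> (Suc i) < \<alpha> i + 1"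
    and "\<alpha> (nL L) = \<alpha> 0 + L"
proof -
  have L: "L > 0" using assms by simp
  define \<alpha> where "\<alpha> i = rep L (a 0) + (\<Sum>j<i. pos_arc_length L (a j) (a (Suc j)))" for i
  have car: "a i \<in> carrier (circle L)" if "i \<le> nL L" for i
    using assms(2) that by (simp add: orienting_loop_def)
  have step: "\<alpha> i < \<alpha> (Suc i)" "\<alpha> (Suc i) < \<alpha> i + 1" if "i < nL L" for i
    using orienting_loop_step[OF L assms(2) that] by (simp_all add: \<alpha>_def)
  have lift: "cls L (\<alpha> i) = a i" if "i \<le> nL L" for i
    using that
  proof (induction i)
    case 0
    then show ?case using rep_props[OF L car] by (simp add: \<alpha>_def)
  next
    case (Suc i)
    have "\<alpha> (Suc i) = \<alpha> i + pos_arc_length L (a i) (a (Suc i))"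
      by (simp add: \<alpha>_def)
    with Suc car show ?case
      using cls_pos_arc_length[OF L, of "a i" "a (Suc i)" "\<alpha> i"] by simp
  qed
  have bound: "\<alpha> 0 \<le> \<alpha> i \<and> \<alpha> i \<le> \<alpha> 0 + of_nat i" if "i \<le> nL L" for i
    using that
  proof (induction i)
    case (Suc i)
    then show ?case using step[of i] by auto
  qed simp
  have n: "nL L > 0" "of_nat (nL L) \<le> L + 1"
    using L by (simp_all add: nL_def)
  have "cls L (\<alpha> 0) = cls L (\<alpha> (nL L))"
    using lift assms(2) by (simp add: orienting_loop_def)
  then obtain k :: int where k: "\<alpha> (nL L) = of_int k * L + \<alpha> 0"
    unfolding cls_eq_iff by blast
  have "\<alpha> 0 < \<alpha> (nL L)"
    using bound[of "nL L - 1"] step[of "nL L - 1"] n by simp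
  then have "of_int 0 * L < of_int k * L" "of_int k * L < of_int 2 * L"
    using k bound[of "nL L"] n assms(1) by linarith+
  from int_multiple_bounds[OF L this] have "k = 1"
    by simp
  with k have "\<alpha> (nL L) = \<alpha> 0 + L" by simp
  with lift step show ?thesis by (intro that) auto
qed

text \<open>Density is applied at the midpoint with radius half the length, and the point found is
  translated by a multiple of L into the interval.\<close>

lemma dense_lift:
  assumes "L > 0" "dense_in_circle L S" "u < v"
  obtains W where "cls L W \<in> S" "u < W" "W < v"
proof -
  have "(v - u) / 2 > 0" using assms by simp
  then obtain s where s: "s \<in> S" "circle_dist L (cls L ((u + v) / 2)) s < (v - u) / 2"
    using assms(2) unfolding dense_in_circle_def by (metis cls_in_carrier)
  have "s \<in> carrier (circle L)"
    using s assms(2) by (auto simp: dense_in_circle_def)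
  then have rs: "cls L (rep L s) = s"
    using rep_props[OF assms(1)] by simp
  then obtain k :: int where k: "\<bar>(u + v) / 2 - rep L s + of_int k * L\<bar> < (v - u) / 2"
    using s(2) circle_dist_less_iff[OF assms(1), of "(u + v) / 2" "rep L s" "(v - u) / 2"] by auto
  have "cls L (rep L s) = cls L (rep L s - of_int k * L)"
    unfolding cls_eq_iff by (intro exI[of _ "- k"]) simp
  then have "cls L (rep L s - of_int k * L) \<in> S"
    using rs s(1) by simp
  then show ?thesis
    using k unfolding abs_less_iff by (intro that[of "rep L s - of_int k * L"]) argo+
qed

section \<open>Closure properties of first-order definable relations\<close>

text \<open>Quantifying over the terms that are plugged into the relation makes substitution and the
  choice of fresh bound variables immediate. Relations of lower arity ignore the last arguments.\<close>

definition fo_rel :: "'a struct \<Rightarrow> ('a \<Rightarrow> 'a \<Rightarrow> 'a \<Rightarrow> bool) \<Rightarrow> bool" where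
  "fo_rel M R \<longleftrightarrow> (\<forall>r s t. consts_term r \<union> consts_term s \<union> consts_term t \<subseteq> csyms M \<longrightarrow>
     (\<exists>p. fv p \<subseteq> fv_term r \<union> fv_term s \<union> fv_term t \<and> consts_form p \<subseteq> csyms M \<and>
       (\<forall>e. (\<forall>v \<in> fv_term r \<union> fv_term s \<union> fv_term t. e v \<in> univ M) \<longrightarrow>
         (sat M e p \<longleftrightarrow> R (val M e r) (val M e s) (val M e t)))))"

text \<open>These are the argument functions that terms represent without new variables;
  substituting them permutes, identifies or fixes arguments.\<close>

definition fo_arg :: "'a struct \<Rightarrow> ('a \<Rightarrow> 'a \<Rightarrow> 'a \<Rightarrow> 'a) \<Rightarrow> bool" where
  "fo_arg M f \<longleftrightarrow> f = (\<lambda>x y w. x) \<or> f = (\<lambda>x y w. y) \<or> f = (\<lambda>x y w. w) \<or>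
     (\<exists>c \<in> csyms M. f = (\<lambda>x y w. const M c))"

lemma fo_arg_intros:
  "fo_arg M (\<lambda>x y w. x)" "fo_arg M (\<lambda>x y w. y)" "fo_arg M (\<lambda>x y w. w)"
  "c \<in> csyms M \<Longrightarrow> fo_arg M (\<lambda>x y w. const M c)"
  by (auto simp: fo_arg_def)

lemma fo_arg_term:
  assumes "fo_arg M f" "consts_term r \<union> consts_term s \<union> consts_term t \<subseteq> csyms M"
  obtains u where "fv_term u \<subseteq> fv_term r \<union> fv_term s \<union> fv_term t" "consts_term u \<subseteq> csyms M"
    and "\<And>e. val M e u = f (val M e r) (val M e s) (val M e t)"
  using assms(1) unfolding fo_arg_def
proof (elim disjE bexE)
  fix c assume "c \<in> csyms M" "f = (\<lambda>x y w. const M c)"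
  then show ?thesis by (intro that[of "Const c"]) auto
qed (use assms(2) that[of r] that[of s] that[of t] in auto)

lemma fo_rel_subst:
  assumes R: "fo_rel M R" and f: "fo_arg M f" and g: "fo_arg M g" and h: "fo_arg M h"
  shows "fo_rel M (\<lambda>x y w. R (f x y w) (g x y w) (h x y w))"
  unfolding fo_rel_def
proof (intro allI impI)
  fix r s t assume c: "consts_term r \<union> consts_term s \<union> consts_term t \<subseteq> csyms M"
  obtain r' where r': "fv_term r' \<subseteq> fv_term r \<union> fv_term s \<union> fv_term t" "consts_term r' \<subseteq> csyms M"
    "\<And>e. val M e r' = f (val M e r) (val M e s) (val M e t)"
    by (rule fo_arg_term[OF f c]) (rule that)
  obtain s' where s': "fv_term s' \<subseteq> fv_term r \<union> fv_term s \<union> fv_term t" "consts_term s' \<subseteq> csyms M"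
    "\<And>e. val M e s' = g (val M e r) (val M e s) (val M e t)"
    by (rule fo_arg_term[OF g c]) (rule that)
  obtain t' where t': "fv_term t' \<subseteq> fv_term r \<union> fv_term s \<union> fv_term t" "consts_term t' \<subseteq> csyms M"
    "\<And>e. val M e t' = h (val M e r) (val M e s) (val M e t)"
    by (rule fo_arg_term[OF h c]) (rule that)
  have "consts_term r' \<union> consts_term s' \<union> consts_term t' \<subseteq> csyms M"
    using r' s' t' by auto
  with R obtain p where p: "fv p \<subseteq> fv_term r' \<union> fv_term s' \<union> fv_term t'" "consts_form p \<subseteq> csyms M"
    "\<And>e. (\<forall>v \<in> fv_term r' \<union> fv_term s' \<union> fv_term t'. e v \<in> univ M) \<Longrightarrow>
       sat M e p \<longleftrightarrow> R (val M e r') (val M e s') (val M e t')"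
    unfolding fo_rel_def by blast
  show "\<exists>p. fv p \<subseteq> fv_term r \<union> fv_term s \<union> fv_term t \<and> consts_form p \<subseteq> csyms M \<and>
       (\<forall>e. (\<forall>v \<in> fv_term r \<union> fv_term s \<union> fv_term t. e v \<in> univ M) \<longrightarrow>
         (sat M e p \<longleftrightarrow> R (f (val M e r) (val M e s) (val M e t))
            (g (val M e r) (val M e s) (val M e t)) (h (val M e r) (val M e s) (val M e t))))"
  proof (intro exI[of _ p] conjI allI impI)
    show "fv p \<subseteq> fv_term r \<union> fv_term s \<union> fv_term t" "consts_form p \<subseteq> csyms M"
      using p(1,2) r'(1) s'(1) t'(1) by auto
    fix e assume "\<forall>v \<in> fv_term r \<union> fv_term s \<union> fv_term t. e v \<in> univ M"
    then have "\<forall>v \<in> fv_term r' \<union> fv_term s' \<union> fv_term t'. e v \<in> univ M"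
      using r'(1) s'(1) t'(1) by blast
    from p(3)[OF this]
    show "sat M e p \<longleftrightarrow> R (f (val M e r) (val M e s) (val M e t))
            (g (val M e r) (val M e s) (val M e t)) (h (val M e r) (val M e s) (val M e t))"
      by (simp add: r'(3) s'(3) t'(3))
  qed
qed

lemma fo_rel_subst1:
  assumes "fo_rel M (\<lambda>x y w. R x)" "fo_arg M f"
  shows "fo_rel M (\<lambda>x y w. R (f x y w))"
  using fo_rel_subst[OF assms fo_arg_intros(1) fo_arg_intros(1)] .

lemma fo_rel_subst2:
  assumes "fo_rel M (\<lambda>x y w. R x y)" "fo_arg M f" "fo_arg M g"
  shows "fo_rel M (\<lambda>x y w. R (f x y w) (g x y w))"
  using fo_rel_subst[OF assms fo_arg_intros(1)] .

lemma fo_rel_brel: "fo_rel M (\<lambda>x y w. brel M x y)"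
  unfolding fo_rel_def
proof (intro allI impI)
  fix r s t assume "consts_term r \<union> consts_term s \<union> consts_term t \<subseteq> csyms M"
  then show "\<exists>p. fv p \<subseteq> fv_term r \<union> fv_term s \<union> fv_term t \<and> consts_form p \<subseteq> csyms M \<and>
       (\<forall>e. (\<forall>v \<in> fv_term r \<union> fv_term s \<union> fv_term t. e v \<in> univ M) \<longrightarrow>
         (sat M e p \<longleftrightarrow> brel M (val M e r) (val M e s)))"
    by (intro exI[of _ "Rel r s"]) auto
qed

lemma fo_rel_eq: "fo_rel M (\<lambda>x y w. x = y)"
  unfolding fo_rel_def
proof (intro allI impI)
  fix r s t assume "consts_term r \<union> consts_term s \<union> consts_term t \<subseteq> csyms M"
  then show "\<exists>p. fv p \<subseteq> fv_term r \<union> fv_term s \<union> fv_term t \<and> consts_form p \<subseteq> csyms M \<and>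
       (\<forall>e. (\<forall>v \<in> fv_term r \<union> fv_term s \<union> fv_term t. e v \<in> univ M) \<longrightarrow>
         (sat M e p \<longleftrightarrow> val M e r = val M e s))"
    by (intro exI[of _ "Eq r s"]) auto
qed

lemma fo_rel_not:
  assumes "fo_rel M R"
  shows "fo_rel M (\<lambda>x y w. \<not> R x y w)"
  unfolding fo_rel_def
proof (intro allI impI)
  fix r s t assume "consts_term r \<union> consts_term s \<union> consts_term t \<subseteq> csyms M"
  with assms obtain p where "fv p \<subseteq> fv_term r \<union> fv_term s \<union> fv_term t" "consts_form p \<subseteq> csyms M"
    "\<forall>e. (\<forall>v \<in> fv_term r \<union> fv_term s \<union> fv_term t. e v \<in> univ M) \<longrightarrow>
       (sat M e p \<longleftrightarrow> R (val M e r) (val M e s) (val M e t))"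
    unfolding fo_rel_def by blast
  then show "\<exists>p. fv p \<subseteq> fv_term r \<union> fv_term s \<union> fv_term t \<and> consts_form p \<subseteq> csyms M \<and>
       (\<forall>e. (\<forall>v \<in> fv_term r \<union> fv_term s \<union> fv_term t. e v \<in> univ M) \<longrightarrow>
         (sat M e p \<longleftrightarrow> \<not> R (val M e r) (val M e s) (val M e t)))"
    by (intro exI[of _ "Neg p"]) auto
qed

lemma fo_rel_conj:
  assumes "fo_rel M R" "fo_rel M Q"
  shows "fo_rel M (\<lambda>x y w. R x y w \<and> Q x y w)"
  unfolding fo_rel_def
proof (intro allI impI)
  fix r s t assume c: "consts_term r \<union> consts_term s \<union> consts_term t \<subseteq> csyms M"
  from assms(1) c obtain p where "fv p \<subseteq> fv_term r \<union> fv_term s \<union> fv_term t" "consts_form p \<subseteq> csyms M"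
    "\<forall>e. (\<forall>v \<in> fv_term r \<union> fv_term s \<union> fv_term t. e v \<in> univ M) \<longrightarrow>
       (sat M e p \<longleftrightarrow> R (val M e r) (val M e s) (val M e t))"
    unfolding fo_rel_def by blast
  moreover from assms(2) c obtain q where "fv q \<subseteq> fv_term r \<union> fv_term s \<union> fv_term t"
    "consts_form q \<subseteq> csyms M"
    "\<forall>e. (\<forall>v \<in> fv_term r \<union> fv_term s \<union> fv_term t. e v \<in> univ M) \<longrightarrow>
       (sat M e q \<longleftrightarrow> Q (val M e r) (val M e s) (val M e t))"
    unfolding fo_rel_def by blast
  ultimately show "\<exists>p. fv p \<subseteq> fv_term r \<union> fv_term s \<union> fv_term t \<and> consts_form p \<subseteq> csyms M \<and>
       (\<forall>e. (\<forall>v \<in> fv_term r \<union> fv_term s \<union> fv_term t. e v \<in> univ M) \<longrightarrow>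
         (sat M e p \<longleftrightarrow> R (val M e r) (val M e s) (val M e t) \<and> Q (val M e r) (val M e s) (val M e t)))"
    by (intro exI[of _ "Conj p q"]) auto
qed

lemma fo_rel_disj:
  assumes "fo_rel M R" "fo_rel M Q"
  shows "fo_rel M (\<lambda>x y w. R x y w \<or> Q x y w)"
  using fo_rel_not[OF fo_rel_conj[OF fo_rel_not[OF assms(1)] fo_rel_not[OF assms(2)]]] by simp

lemma fo_rel_imp:
  assumes "fo_rel M R" "fo_rel M Q"
  shows "fo_rel M (\<lambda>x y w. R x y w \<longrightarrow> Q x y w)"
  using fo_rel_not[OF fo_rel_conj[OF assms(1) fo_rel_not[OF assms(2)]]] by simp

lemma fo_rel_const: "fo_rel M (\<lambda>x y w. Q)"
proof -
  \<comment> \<open>Truth is expressed as x = x, by identifying the arguments of equality.\<close>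
  have T: "fo_rel M (\<lambda>x y w. True)"
    using fo_rel_subst2[OF fo_rel_eq fo_arg_intros(1) fo_arg_intros(1)] by simp
  show ?thesis
    using T fo_rel_not[OF T] by (cases Q) simp_all
qed

lemma fo_rel_finite_ex:
  assumes "finite A" "\<And>i. i \<in> A \<Longrightarrow> fo_rel M (R i)"
  shows "fo_rel M (\<lambda>x y w. \<exists>i\<in>A. R i x y w)"
  using assms
proof (induction A rule: finite_induct)
  case empty
  then show ?case using fo_rel_const[of M False] by simp
next
  case (insert i A)
  then show ?case using fo_rel_disj[of M "R i" "\<lambda>x y w. \<exists>i\<in>A. R i x y w"] by simp
qed

lemma val_upd_fresh: "n \<notin> fv_term t \<Longrightarrow> val M (e(n := x)) t = val M e t"
  by (cases t) auto

lemma finite_fv_term: "finite (fv_term t)"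
  by (cases t) auto

text \<open>The quantifier always binds the third slot, so the result depends on two arguments only.
  Choosing the bound variable outside r and s suffices, because the new formula is built without
  t.\<close>

lemma fo_rel_ex:
  assumes "fo_rel M R"
  shows "fo_rel M (\<lambda>x y w. \<exists>v\<in>univ M. R x y v)"
  unfolding fo_rel_def
proof (intro allI impI)
  fix r s t assume "consts_term r \<union> consts_term s \<union> consts_term t \<subseteq> csyms M"
  moreover obtain n where n: "n \<notin> fv_term r \<union> fv_term s"
    using ex_new_if_finite[OF infinite_UNIV_nat, of "fv_term r \<union> fv_term s"] finite_fv_term by auto
  ultimately have "consts_term r \<union> consts_term s \<union> consts_term (Var n) \<subseteq> csyms M"
    by simp
  with assms obtain p where p: "fv p \<subseteq> fv_term r \<union> fv_term s \<union> fv_term (Var n)"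
    "consts_form p \<subseteq> csyms M"
    "\<And>e. (\<forall>v \<in> fv_term r \<union> fv_term s \<union> fv_term (Var n). e v \<in> univ M) \<Longrightarrow>
       sat M e p \<longleftrightarrow> R (val M e r) (val M e s) (val M e (Var n))"
    unfolding fo_rel_def by blast
  have "sat M (e(n := x)) p \<longleftrightarrow> R (val M e r) (val M e s) x"
    if "\<forall>v \<in> fv_term r \<union> fv_term s \<union> fv_term t. e v \<in> univ M" "x \<in> univ M" for e x
    using p(3)[of "e(n := x)"] that n by (simp add: val_upd_fresh)
  then show "\<exists>p. fv p \<subseteq> fv_term r \<union> fv_term s \<union> fv_term t \<and> consts_form p \<subseteq> csyms M \<and>
       (\<forall>e. (\<forall>v \<in> fv_term r \<union> fv_term s \<union> fv_term t. e v \<in> univ M) \<longrightarrow>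
         (sat M e p \<longleftrightarrow> (\<exists>v\<in>univ M. R (val M e r) (val M e s) v)))"
    using p(1,2) by (intro exI[of _ "Exi n p"]) auto
qed

lemma fo_rel_all:
  assumes "fo_rel M R"
  shows "fo_rel M (\<lambda>x y w. \<forall>v\<in>univ M. R x y v)"
  using fo_rel_not[OF fo_rel_ex[OF fo_rel_not[OF assms]]] by simp

text \<open>Agreement on the universe is enough, since a term takes its value there as soon as its
  variables do and the constants lie there.\<close>

lemma fo_rel_cong:
  assumes R: "fo_rel M R" and const: "\<And>c. c \<in> csyms M \<Longrightarrow> const M c \<in> univ M"
    and eq: "\<And>x y w. x \<in> univ M \<Longrightarrow> y \<in> univ M \<Longrightarrow> w \<in> univ M \<Longrightarrow> R x y w \<longleftrightarrow> Q x y w"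
  shows "fo_rel M Q"
  unfolding fo_rel_def
proof (intro allI impI)
  fix r s t assume c: "consts_term r \<union> consts_term s \<union> consts_term t \<subseteq> csyms M"
  have val: "val M e u \<in> univ M" if "consts_term u \<subseteq> csyms M" "\<forall>v\<in>fv_term u. e v \<in> univ M" for e u
    using that const by (cases u) auto
  from R c obtain p where "fv p \<subseteq> fv_term r \<union> fv_term s \<union> fv_term t" "consts_form p \<subseteq> csyms M"
    "\<And>e. (\<forall>v \<in> fv_term r \<union> fv_term s \<union> fv_term t. e v \<in> univ M) \<Longrightarrow>
       sat M e p \<longleftrightarrow> R (val M e r) (val M e s) (val M e t)"
    unfolding fo_rel_def by blast
  then show "\<exists>p. fv p \<subseteq> fv_term r \<union> fv_term s \<union> fv_term t \<and> consts_form p \<subseteq> csyms M \<and>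
       (\<forall>e. (\<forall>v \<in> fv_term r \<union> fv_term s \<union> fv_term t. e v \<in> univ M) \<longrightarrow>
         (sat M e p \<longleftrightarrow> Q (val M e r) (val M e s) (val M e t)))"
    using c by (intro exI[of _ p]) (simp add: eq val)
qed

lemma definable_3:
  assumes "fo_rel M R"
  shows "definable M 3 {[x, y, w] | x y w. x \<in> univ M \<and> y \<in> univ M \<and> w \<in> univ M \<and> R x y w}"
proof -
  obtain p where p: "fv p \<subseteq> {0, 1, 2}" "consts_form p \<subseteq> csyms M"
    "\<And>e. e 0 \<in> univ M \<Longrightarrow> e 1 \<in> univ M \<Longrightarrow> e 2 \<in> univ M \<Longrightarrow> sat M e p \<longleftrightarrow> R (e 0) (e 1) (e 2)"
    using assms[unfolded fo_rel_def, rule_format, of "Var 0" "Var 1" "Var 2"] by auto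
  have "sat M ((!) [x, y, w]) p \<longleftrightarrow> R x y w"
    if "x \<in> univ M" "y \<in> univ M" "w \<in> univ M" for x y w
    using p(3)[of "(!) [x, y, w]"] that by (simp add: numeral_2_eq_2)
  moreover have "fv p \<subseteq> {..<3}" using p(1) by auto
  ultimately show ?thesis
    unfolding definable_def using p(2)
    by (intro exI[of _ p]) (auto simp: length_Suc_conv numeral_3_eq_3)
qed

lemma definable_2:
  assumes "fo_rel M (\<lambda>x y w. R x y)"
  shows "definable M 2 {[x, y] | x y. x \<in> univ M \<and> y \<in> univ M \<and> R x y}"
proof -
  obtain p where p: "fv p \<subseteq> {0, 1}" "consts_form p \<subseteq> csyms M"
    "\<And>e. e 0 \<in> univ M \<Longrightarrow> e 1 \<in> univ M \<Longrightarrow> sat M e p \<longleftrightarrow> R (e 0) (e 1)"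
    \<comment> \<open>The relation ignores the third slot; filling it with \<open>Var 1\<close>
      keeps the free variables within {0, 1}.\<close>
    using assms[unfolded fo_rel_def, rule_format, of "Var 0" "Var 1" "Var 1"] by auto
  have "sat M ((!) [x, y]) p \<longleftrightarrow> R x y"
    if "x \<in> univ M" "y \<in> univ M" for x y
    using p(3)[of "(!) [x, y]"] that by simp
  moreover have "fv p \<subseteq> {..<2}" using p(1) by auto
  ultimately show ?thesis
    unfolding definable_def using p(2)
    by (intro exI[of _ p]) (auto simp: length_Suc_conv numeral_2_eq_2)
qed

section \<open>Coordinates along a loop\<close>

text \<open>The loop is now represented by its lift \<open>\<alpha>\<close>, which makes exactly one
  positive turn in steps shorter than 1.\<close>

locale circle_loop =
  fixes L :: real and S :: "real set set" and a :: "nat \<Rightarrow> real set" and \<alpha> :: "nat \<Rightarrow> real"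
  assumes L: "L > 3"
    and dense: "dense_in_circle L S"
    and a_in_S: "i \<le> nL L \<Longrightarrow> a i \<in> S"
    and cls_alpha: "i \<le> nL L \<Longrightarrow> cls L (\<alpha> i) = a i"
    and alpha_step: "i < nL L \<Longrightarrow> \<alpha> i < \<alpha> (Suc i) \<and> \<alpha> (Suc i) < \<alpha> i + 1"
    and alpha_total: "\<alpha> (nL L) = \<alpha> 0 + L"
begin

abbreviation near :: "real set \<Rightarrow> real set \<Rightarrow> bool" where
  "near x y \<equiv> circle_dist L x y < 1"

abbreviation M :: "real set struct" where
  "M \<equiv> SL L S a"

text \<open>Cutting the circle at \<open>a 0\<close> gives each point of S a unique lift in
  [\<alpha> 0, \<alpha> 0 + L), namely this one.\<close>

definition coord :: "real set \<Rightarrow> real" where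
  "coord x = \<alpha> 0 + pos_arc_length L (a 0) x"

lemma L_pos: "L > 0"
  using L by simp

lemma S_carrier: "x \<in> S \<Longrightarrow> x \<in> carrier (circle L)"
  using dense by (auto simp: dense_in_circle_def)

lemma coord_props:
  assumes "x \<in> S"
  shows "\<alpha> 0 \<le> coord x" "coord x < \<alpha> 0 + L" "cls L (coord x) = x"
proof -
  have a0: "a 0 \<in> S" using a_in_S by simp
  note rep_props[OF L_pos S_carrier[OF a0]] rep_props[OF L_pos S_carrier[OF assms]]
  then show "\<alpha> 0 \<le> coord x" "coord x < \<alpha> 0 + L"
    by (auto simp: coord_def pos_arc_length_def)
  show "cls L (coord x) = x"
    unfolding coord_def
    using S_carrier[OF a0] S_carrier[OF assms] cls_alpha
    by (intro cls_pos_arc_length[OF L_pos]) auto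
qed

lemma lift_coord:
  assumes "cls L u = x" "x \<in> S"
  obtains k :: int where "u = coord x + of_int k * L"
proof -
  have "cls L (coord x) = cls L u"
    using assms coord_props(3) by simp
  then show ?thesis
    unfolding cls_eq_iff using that by (auto simp: add.commute)
qed

lemma coord_eqI:
  assumes "x \<in> S" "cls L u = x" "\<alpha> 0 \<le> u" "u < \<alpha> 0 + L"
  shows "coord x = u"
proof -
  obtain k :: int where k: "u = coord x + of_int k * L"
    using lift_coord assms by blast
  then have "of_int (-1) * L < of_int k * L" "of_int k * L < of_int 1 * L"
    using k coord_props[OF assms(1)] assms(3,4) by linarith+
  from int_multiple_bounds[OF L_pos this] have "k = 0"
    by simp
  with k show ?thesis by simp
qed

text \<open>The window lies in three consecutive periods, so only three values of m occur. This
  turns a quantifier over turns into a finite disjunction.\<close>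

lemma dense_window:
  assumes "u < v" "\<alpha> 0 - L \<le> u" "v \<le> \<alpha> 0 + 2 * L"
  obtains w and m :: int where "w \<in> S" "m \<in> {-1, 0, 1}"
    and "u < coord w + of_int m * L" "coord w + of_int m * L < v"
proof -
  obtain W where W: "cls L W \<in> S" "u < W" "W < v"
    using dense_lift[OF L_pos dense assms(1)] .
  obtain m :: int where m: "W = coord (cls L W) + of_int m * L"
    using lift_coord W(1) by blast
  have "of_int (-2) * L < of_int m * L" "of_int m * L < of_int 2 * L"
    using m W assms(2,3) coord_props[OF W(1)] by linarith+
  then have "-2 < m" "m < 2"
    using int_multiple_bounds[OF L_pos] by blast+
  then have "m \<in> {-1, 0, 1}" by auto
  with W m show ?thesis by (intro that[of "cls L W" m]) auto
qed

lemma dense_coord: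
  assumes "u < v" "\<alpha> 0 \<le> u" "v \<le> \<alpha> 0 + L"
  obtains w where "w \<in> S" "u < coord w" "coord w < v"
proof -
  obtain W where W: "cls L W \<in> S" "u < W" "W < v"
    using dense_lift[OF L_pos dense assms(1)] .
  then have "coord (cls L W) = W"
    using assms(2,3) by (intro coord_eqI) auto
  with W show ?thesis by (intro that[of "cls L W"]) auto
qed

lemma near_commute: "near x y \<longleftrightarrow> near y x"
  by (simp add: circle_dist_def abs_minus_commute)

lemma near_clsI: "\<bar>u - v\<bar> < 1 \<Longrightarrow> near (cls L u) (cls L v)"
  unfolding circle_dist_less_iff[OF L_pos] by (intro exI[of _ 0]) simp

text \<open>Such a difference is at least 1 away from both 0 and L, hence from every multiple of
  L.\<close>

lemma not_near_cls:
  assumes "1 \<le> u - v" "u - v \<le> L - 1"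
  shows "\<not> near (cls L u) (cls L v)"
proof -
  have "1 \<le> \<bar>u - v + of_int k * L\<bar>" for k :: int
    using abs_add_multiple_ge[OF L_pos, of "u - v" k] assms by auto
  then show ?thesis
    unfolding circle_dist_less_iff[OF L_pos] by (auto simp: not_less)
qed

lemma near_lift:
  assumes "near (cls L u) w" "w \<in> S"
  obtains W where "cls L W = w" "\<bar>u - W\<bar> < 1"
proof -
  obtain k :: int where k: "\<bar>u - coord w + of_int k * L\<bar> < 1"
    using assms circle_dist_less_iff[OF L_pos, of u "coord w"] coord_props[OF assms(2)] by auto
  have "cls L (coord w) = cls L (coord w - of_int k * L)"
    unfolding cls_eq_iff by (intro exI[of _ "- k"]) simp
  with k show ?thesis
    using coord_props[OF assms(2)] by (intro that[of "coord w - of_int k * L"]) auto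
qed

text \<open>The second case comes from the cut at \<open>a 0\<close>: points on opposite sides of it
  are near although their coordinates differ by almost a full turn.\<close>

lemma near_iff:
  assumes "x \<in> S" "y \<in> S" "coord x \<le> coord y"
  shows "near x y \<longleftrightarrow> coord y - coord x < 1 \<or> L - 1 < coord y - coord x"
proof
  assume "near x y"
  then have "near (cls L (coord y)) (cls L (coord x))"
    using coord_props(3) assms by (simp add: near_commute)
  then show "coord y - coord x < 1 \<or> L - 1 < coord y - coord x"
    using not_near_cls[of "coord y" "coord x"] by linarith
next
  assume "coord y - coord x < 1 \<or> L - 1 < coord y - coord x"
  then have "\<bar>coord x - coord y + of_int 0 * L\<bar> < 1 \<or> \<bar>coord x - coord y + of_int 1 * L\<bar> < 1"
    using coord_props[OF assms(1)] coord_props[OF assms(2)] assms(3) by auto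
  then have "near (cls L (coord x)) (cls L (coord y))"
    unfolding circle_dist_less_iff[OF L_pos] by blast
  then show "near x y"
    using coord_props(3) assms by simp
qed

section \<open>Defining the arcs of the loop and the order on them\<close>

text \<open>Removing the right end point makes the arcs half-open, so that each point of S belongs
  to exactly one of them.\<close>

definition in_arc :: "nat \<Rightarrow> real set \<Rightarrow> bool" where
  "in_arc i x \<longleftrightarrow> x \<noteq> a (Suc i) \<and> (\<forall>w\<in>S. near x w \<longrightarrow> near w (a i) \<or> near w (a (Suc i)))"

definition before :: "nat \<Rightarrow> real set \<Rightarrow> real set \<Rightarrow> bool" where
  "before i x y \<longleftrightarrow> (\<exists>w\<in>S. near x w \<and> \<not> near y w \<and> \<not> near w (a (Suc i)))"

lemma alpha_mono: "i \<le> j \<Longrightarrow> j \<le> nL L \<Longrightarrow> \<alpha> i \<le> \<alpha> j"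
proof (induction j rule: dec_induct)
  case (step j)
  then show ?case using alpha_step[of j] by auto
qed simp

lemma alpha_range: "i \<le> nL L \<Longrightarrow> \<alpha> 0 \<le> \<alpha> i \<and> \<alpha> i \<le> \<alpha> 0 + L"
  using alpha_mono[of 0 i] alpha_mono[of i "nL L"] alpha_total by auto

text \<open>The points near \<open>a i\<close> or \<open>a (Suc i)\<close> form an arc of length less than 3, and the unit
  neighbourhood of \<open>x\<close> stays inside it only if \<open>x\<close> lies between these two points.\<close>

lemma in_arc_iff:
  assumes x: "x \<in> S" and i: "i < nL L"
  shows "in_arc i x \<longleftrightarrow> \<alpha> i \<le> coord x \<and> coord x < \<alpha> (Suc i)"
proof
  let ?p = "\<alpha> i" and ?q = "\<alpha> (Suc i)"
  have pq: "?p < ?q" "?q < ?p + 1" "\<alpha> 0 \<le> ?p" "?q \<le> \<alpha> 0 + L"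
    using alpha_step[OF i] alpha_range[of i] alpha_range[of "Suc i"] i by auto
  have cls_pq: "cls L ?p = a i" "cls L ?q = a (Suc i)"
    using cls_alpha i by auto
  note cx = coord_props[OF x]
  {
    assume arc: "?p \<le> coord x \<and> coord x < ?q"
    have "x \<noteq> a (Suc i)"
    proof
      assume "x = a (Suc i)"
      then obtain k :: int where "?q = coord x + of_int k * L"
        using lift_coord cls_pq(2) x by blast
      then have "of_int 0 * L < of_int k * L" "of_int k * L < of_int 1 * L"
        using arc pq L by linarith+
      from int_multiple_bounds[OF L_pos this] show False
        by simp
    qed
    moreover have "near w (a i) \<or> near w (a (Suc i))" if w: "w \<in> S" "near x w" for w
    proof -
      obtain W where W: "cls L W = w" "\<bar>coord x - W\<bar> < 1"
        using near_lift[of "coord x" w] w cx(3) by auto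
      \<comment> \<open>If W < p + 1, then W is within 1 of p; otherwise q < p + 1 \<le> W < q +
        1.\<close>
      have "\<bar>W - ?p\<bar> < 1 \<or> \<bar>W - ?q\<bar> < 1"
        using W(2) arc pq by (auto simp: abs_if)
      then show ?thesis
        using near_clsI W(1) cls_pq by metis
    qed
    ultimately show "in_arc i x"
      by (auto simp: in_arc_def)
  }
  {
    assume arc: "in_arc i x"
    show "?p \<le> coord x \<and> coord x < ?q"
    proof (rule ccontr)
      assume out: "\<not> ?thesis"
      \<comment> \<open>X is the lift of x in the complementary gap between q and p + L.\<close>
      define X where "X = (if coord x < ?p then coord x + L else coord x)"
      have "cls L (coord x) = cls L (coord x + L)"
        unfolding cls_eq_iff by (intro exI[of _ 1]) simp
      then have clsX: "cls L X = x"
        using cx by (simp add: X_def)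
      have "X \<noteq> ?q"
        using clsX cls_pq arc by (auto simp: in_arc_def)
      then have X: "?q < X" "X < ?p + L"
        using out pq cx by (auto simp: X_def split: if_splits)
      \<comment> \<open>A point W in this interval is within 1 of X but at least 1 away from q and
        from p + L. The interval is nonempty because q - p < 1 < L - 2.\<close>
      have "max (?q + 1) (X - 1) < min (?p + L - 1) (X + 1)"
        using X pq L by auto
      then obtain W where W: "cls L W \<in> S" "max (?q + 1) (X - 1) < W" "W < min (?p + L - 1) (X + 1)"
        using dense_lift[OF L_pos dense] by blast
      then have "near x (cls L W)"
        using near_clsI[of X W] clsX by auto
      moreover have "\<not> near (cls L W) (a i)"
        using not_near_cls[of W ?p] W pq cls_pq by auto
      moreover have "\<not> near (cls L W) (a (Suc i))"
        using not_near_cls[of W ?q] W pq cls_pq by auto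
      ultimately show False
        using arc W(1) by (auto simp: in_arc_def)
    qed
  }
qed

text \<open>The points near \<open>x\<close> but not near \<open>y\<close> lie to the left of the arc if \<open>x\<close> precedes \<open>y\<close>, and to
  its right otherwise; only in the latter case are they near its end point \<open>a (Suc i)\<close>.\<close>

lemma before_iff:
  assumes x: "x \<in> S" and y: "y \<in> S" and i: "i < nL L" and "in_arc i x" "in_arc i y"
  shows "before i x y \<longleftrightarrow> coord x < coord y"
proof
  let ?p = "\<alpha> i" and ?q = "\<alpha> (Suc i)"
  have pq: "?p < ?q" "?q < ?p + 1"
    using alpha_step[OF i] by auto
  have cls_q: "cls L ?q = a (Suc i)"
    using cls_alpha i by auto
  have xy: "?p \<le> coord x" "coord x < ?q" "?p \<le> coord y" "coord y < ?q"
    using assms in_arc_iff by auto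
  note cx = coord_props[OF x] and cy = coord_props[OF y]
  {
    assume less: "coord x < coord y"
    \<comment> \<open>W is less than 1 to the left of x, but more than 1 to the left of y and hence
      of q.\<close>
    then obtain W where W: "cls L W \<in> S" "coord x - 1 < W" "W < coord y - 1"
      using dense_lift[OF L_pos dense, of "coord x - 1" "coord y - 1"] by auto
    have "near x (cls L W)"
      using near_clsI[of "coord x" W] W xy pq cx by auto
    moreover have "\<not> near y (cls L W)"
      using not_near_cls[of "coord y" W] W xy pq cy L by auto
    moreover have "\<not> near (a (Suc i)) (cls L W)"
      using not_near_cls[of ?q W] W xy pq cls_q L by auto
    ultimately show "before i x y"
      using W(1) by (auto simp: before_def near_commute)
  }
  {
    assume "before i x y"
    then obtain w where w: "w \<in> S" "near x w" "\<not> near y w" "\<not> near w (a (Suc i))"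
      by (auto simp: before_def)
    then obtain W where W: "cls L W = w" "\<bar>coord x - W\<bar> < 1"
      using near_lift[of "coord x" w] cx(3) by auto
    have "\<not> \<bar>coord y - W\<bar> < 1" "\<not> \<bar>W - ?q\<bar> < 1"
      using near_clsI w W(1) cy cls_q by metis+
    \<comment> \<open>Since W < q + 1, avoiding q forces W \<le> q - 1 < p \<le> coord y. Avoiding y
      then gives coord x - 1 < W \<le> coord y - 1.\<close>
    then show "coord x < coord y"
      using W(2) xy pq by (auto simp: abs_if split: if_splits)
  }
qed

lemma ex_in_arc:
  assumes "x \<in> S"
  shows "\<exists>i<nL L. in_arc i x"
proof -
  have "\<exists>i<m. \<alpha> i \<le> u \<and> u < \<alpha> (Suc i)" if "\<alpha> 0 \<le> u" "u < \<alpha> m" for u m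
    using that
  proof (induction m)
    case (Suc m)
    then show ?case by (cases "u < \<alpha> m") (auto intro: less_SucI)
  qed simp
  from this[of "coord x" "nL L"] show ?thesis
    using coord_props[OF assms] alpha_total in_arc_iff[OF assms] by auto
qed

text \<open>This is a lexicographic comparison, first by the index of the arc and then inside a
  common arc.\<close>

lemma coord_less_iff:
  assumes x: "x \<in> S" and y: "y \<in> S"
  shows "coord x < coord y \<longleftrightarrow>
    (\<exists>i\<in>{..<nL L}. \<exists>j\<in>{i..<nL L}. in_arc i x \<and> in_arc j y \<and> (i = j \<longrightarrow> before i x y))"
proof
  assume less: "coord x < coord y"
  obtain i where i: "i < nL L" "in_arc i x" using ex_in_arc[OF x] by blast
  obtain j where j: "j < nL L" "in_arc j y" using ex_in_arc[OF y] by blast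
  have "\<not> j < i"
    using alpha_mono[of "Suc j" i] less i j in_arc_iff[OF x i(1)] in_arc_iff[OF y j(1)] by auto
  moreover have "before i x y" if "i = j"
    using before_iff[OF x y i(1)] i j that less by simp
  ultimately show "\<exists>i\<in>{..<nL L}. \<exists>j\<in>{i..<nL L}. in_arc i x \<and> in_arc j y \<and> (i = j \<longrightarrow> before i x y)"
    using i j by (intro bexI[of _ i] bexI[of _ j]) auto
next
  assume "\<exists>i\<in>{..<nL L}. \<exists>j\<in>{i..<nL L}. in_arc i x \<and> in_arc j y \<and> (i = j \<longrightarrow> before i x y)"
  then obtain i j where ij: "i \<le> j" "j < nL L" "in_arc i x" "in_arc j y" "i = j \<longrightarrow> before i x y"
    by auto
  show "coord x < coord y"
  proof (cases "i = j")
    case True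
    then show ?thesis using before_iff[OF x y] ij by auto
  next
    case False
    then show ?thesis
      using alpha_mono[of "Suc i" j] ij in_arc_iff[OF x, of i] in_arc_iff[OF y, of j] by auto
  qed
qed

section \<open>First-order definability of the coordinate order\<close>

lemma SL_simps [simp]: "univ M = S" "brel M = near" "csyms M = {..nL L}" "const M = a"
  by (simp_all add: SL_def)

lemma fo_rel_eqI:
  assumes "fo_rel M R" "\<And>x y w. x \<in> S \<Longrightarrow> y \<in> S \<Longrightarrow> w \<in> S \<Longrightarrow> Q x y w \<longleftrightarrow> R x y w"
  shows "fo_rel M Q"
  using assms(1) by (rule fo_rel_cong) (auto simp: assms(2) a_in_S)

lemma fo_arg_loop: "i \<le> nL L \<Longrightarrow> fo_arg M (\<lambda>x y w. a i)"
  using fo_arg_intros(4)[of i M] by simp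

lemmas fo_args = fo_arg_intros(1-3) fo_arg_loop

lemma fo_rel_near: "fo_rel M (\<lambda>x y w. near x y)"
  using fo_rel_brel[of M] by simp

lemmas fo_rel_near' = fo_rel_subst2[OF fo_rel_near]
lemmas fo_rel_eq' = fo_rel_subst2[OF fo_rel_eq]

lemma fo_rel_bex: "fo_rel M R \<Longrightarrow> fo_rel M (\<lambda>x y w. \<exists>v\<in>S. R x y v)"
  using fo_rel_ex[of M R] by simp

lemma fo_rel_ball: "fo_rel M R \<Longrightarrow> fo_rel M (\<lambda>x y w. \<forall>v\<in>S. R x y v)"
  using fo_rel_all[of M R] by simp

lemma fo_rel_in_arc:
  assumes "i < nL L"
  shows "fo_rel M (\<lambda>x y w. in_arc i x)"
  unfolding in_arc_def using assms
  by (intro fo_rel_conj fo_rel_not fo_rel_ball fo_rel_imp fo_rel_disj fo_rel_near' fo_rel_eq' fo_args) auto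

lemma fo_rel_before:
  assumes "i < nL L"
  shows "fo_rel M (\<lambda>x y w. before i x y)"
  unfolding before_def using assms
  by (intro fo_rel_conj fo_rel_not fo_rel_bex fo_rel_near' fo_args) auto

lemma fo_rel_less: "fo_rel M (\<lambda>x y w. coord x < coord y)"
proof (rule fo_rel_eqI)
  show "fo_rel M (\<lambda>x y w. \<exists>i\<in>{..<nL L}. \<exists>j\<in>{i..<nL L}.
      in_arc i x \<and> in_arc j y \<and> (i = j \<longrightarrow> before i x y))"
    by (intro fo_rel_finite_ex fo_rel_conj fo_rel_imp fo_rel_const fo_rel_before
        fo_rel_subst1[OF fo_rel_in_arc] fo_args) auto
qed (rule coord_less_iff)

lemmas fo_rel_less' = fo_rel_subst2[OF fo_rel_less]

section \<open>Defining the comparison of shifted coordinates\<close>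

text \<open>Nearness across the cut has to be excluded. If the coordinates differ by more than L -
  1, density yields a point v between them whose difference from x lies between 1 and L - 1, so v is
  not near x.\<close>

lemma fo_rel_adjacent: "fo_rel M (\<lambda>x y w. coord x < coord y \<and> coord y < coord x + 1)"
proof (rule fo_rel_eqI)
  show "fo_rel M (\<lambda>x y w. coord x < coord y \<and> near x y \<and>
      (\<forall>v\<in>S. coord x < coord v \<and> coord v < coord y \<longrightarrow> near x v))"
  proof (intro fo_rel_conj fo_rel_less' fo_rel_near' fo_args)
    have "fo_rel M (\<lambda>x y v. coord x < coord v \<and> coord v < coord y \<longrightarrow> near x v)"
      by (intro fo_rel_conj fo_rel_imp fo_rel_less' fo_rel_near' fo_args)
    then show "fo_rel M (\<lambda>x y w. \<forall>v\<in>S. coord x < coord v \<and> coord v < coord y \<longrightarrow> near x v)"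
      by (rule fo_rel_ball)
  qed
next
  fix x y assume xy: "x \<in> S" "y \<in> S"
  note c = coord_props[OF xy(1)] coord_props[OF xy(2)]
  show "coord x < coord y \<and> coord y < coord x + 1 \<longleftrightarrow> coord x < coord y \<and> near x y \<and>
      (\<forall>v\<in>S. coord x < coord v \<and> coord v < coord y \<longrightarrow> near x v)" (is "?l \<longleftrightarrow> ?r")
  proof
    assume ?l
    then show ?r using xy by (auto simp: near_iff)
  next
    assume r: ?r
    have "False" if far: "L - 1 < coord y - coord x"
    proof -
      obtain v where "v \<in> S" "coord x + 1 < coord v" "coord v < coord x + L - 1"
        using dense_coord[of "coord x + 1" "coord x + L - 1"] far c L by auto
      then show False
        using r far xy near_iff[OF xy(1)] by auto
    qed
    then show ?l using r near_iff[OF xy] by auto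
  qed
qed

lemmas fo_rel_adjacent' = fo_rel_subst2[OF fo_rel_adjacent]

lemma multiple_ge: "(j::int) \<le> m \<Longrightarrow> of_int j * L \<le> of_int m * L"
  using L_pos by (intro mult_right_mono) auto

text \<open>Coordinates differ by less than L, which decides the inequality for all m except 0 and
  1. In these two cases a point v of S interpolates the strict inequality.\<close>

lemma fo_rel_plus_one: "fo_rel M (\<lambda>x y w. coord x + 1 < coord y + of_int m * L)"
proof -
  consider "m \<ge> 2" | "m = 1" | "m = 0" | "m \<le> -1" by linarith
  then show ?thesis
  proof cases
    case 1
    then show ?thesis
    proof (intro fo_rel_eqI[OF fo_rel_const[of _ True]])
      fix x y assume "x \<in> S" "y \<in> S"
      then have "coord x + 1 < coord y + of_int m * L"
        using coord_props[of x] coord_props[of y] multiple_ge[OF 1] L by linarith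
      then show "coord x + 1 < coord y + of_int m * L \<longleftrightarrow> True" by simp
    qed
  next
    case 4
    then show ?thesis
    proof (intro fo_rel_eqI[OF fo_rel_const[of _ False]])
      fix x y assume "x \<in> S" "y \<in> S"
      then have "\<not> coord x + 1 < coord y + of_int m * L"
        using coord_props[of x] coord_props[of y] multiple_ge[OF 4] L by linarith
      then show "coord x + 1 < coord y + of_int m * L \<longleftrightarrow> False" by simp
    qed
  next
    case 3
    show ?thesis
    proof (rule fo_rel_eqI)
      \<comment> \<open>The conditions say coord x + 1 \<le> coord v < coord y.\<close>
      have "fo_rel M (\<lambda>x y v. coord x < coord v \<and> coord v < coord y \<and>
          \<not> (coord x < coord v \<and> coord v < coord x + 1))"
        by (intro fo_rel_conj[OF _ fo_rel_conj] fo_rel_not fo_rel_less' fo_rel_adjacent' fo_args)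
      then show "fo_rel M (\<lambda>x y w. \<exists>v\<in>S. coord x < coord v \<and> coord v < coord y \<and>
          \<not> (coord x < coord v \<and> coord v < coord x + 1))"
        by (rule fo_rel_bex)
    next
      fix x y assume xy: "x \<in> S" "y \<in> S"
      note c = coord_props[OF xy(1)] coord_props[OF xy(2)]
      show "coord x + 1 < coord y + of_int m * L \<longleftrightarrow> (\<exists>v\<in>S. coord x < coord v \<and> coord v < coord y \<and>
          \<not> (coord x < coord v \<and> coord v < coord x + 1))" (is "?l \<longleftrightarrow> ?r")
      proof
        assume ?l
        then obtain v where "v \<in> S" "coord x + 1 < coord v" "coord v < coord y"
          using dense_coord[of "coord x + 1" "coord y"] c 3 by auto
        then show ?r by (intro bexI[of _ v]) auto
      qed (use 3 in auto)
    qed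
  next
    case 2
    show ?thesis
    proof (rule fo_rel_eqI)
      \<comment> \<open>The disjunction says coord v \<le> coord y + L - 1: nearness with a positive
        difference of at least 1 means a difference above L - 1. Strictness comes from coord x <
        coord v.\<close>
      have "fo_rel M (\<lambda>x y v. coord x < coord v \<and>
          (\<not> coord y < coord v \<or> coord y < coord v \<and> coord v < coord y + 1 \<or> \<not> near y v))"
        by (intro fo_rel_conj[OF fo_rel_less'] fo_rel_disj fo_rel_not fo_rel_less'
            fo_rel_adjacent' fo_rel_near' fo_args)
      then show "fo_rel M (\<lambda>x y w. \<exists>v\<in>S. coord x < coord v \<and>
          (\<not> coord y < coord v \<or> coord y < coord v \<and> coord v < coord y + 1 \<or> \<not> near y v))"
        by (rule fo_rel_bex)
    next
      fix x y assume xy: "x \<in> S" "y \<in> S"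
      note c = coord_props[OF xy(1)] coord_props[OF xy(2)]
      show "coord x + 1 < coord y + of_int m * L \<longleftrightarrow> (\<exists>v\<in>S. coord x < coord v \<and>
          (\<not> coord y < coord v \<or> coord y < coord v \<and> coord v < coord y + 1 \<or> \<not> near y v))"
        (is "?l \<longleftrightarrow> ?r")
      proof
        assume ?l
        then obtain v where v: "v \<in> S" "coord x < coord v" "coord v < min (\<alpha> 0 + L) (coord y + L - 1)"
          using dense_coord[of "coord x" "min (\<alpha> 0 + L) (coord y + L - 1)"] c 2 by auto
        then show ?r
          using near_iff[OF xy(2) v(1)] by (intro bexI[of _ v]) auto
      next
        assume ?r
        then obtain v where v: "v \<in> S" "coord x < coord v"
          "\<not> coord y < coord v \<or> coord v < coord y + 1 \<or> \<not> near y v" by auto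
        then show ?l
          using near_iff[OF xy(2) v(1)] 2 L by auto
      qed
    qed
  qed
qed

text \<open>Only m = 0 and m = -1 are not decided by the range of the coordinates. For m = -1 the
  inequality says that the difference exceeds L - 1, which is nearness across the cut.\<close>

lemma fo_rel_minus_one: "fo_rel M (\<lambda>x y w. coord x - 1 < coord y + of_int m * L)"
proof -
  consider "m \<ge> 1" | "m = 0" | "m = -1" | "m \<le> -2" by linarith
  then show ?thesis
  proof cases
    case 1
    then show ?thesis
    proof (intro fo_rel_eqI[OF fo_rel_const[of _ True]])
      fix x y assume "x \<in> S" "y \<in> S"
      then have "coord x - 1 < coord y + of_int m * L"
        using coord_props[of x] coord_props[of y] multiple_ge[OF 1] L by linarith
      then show "coord x - 1 < coord y + of_int m * L \<longleftrightarrow> True" by simp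
    qed
  next
    case 4
    then show ?thesis
    proof (intro fo_rel_eqI[OF fo_rel_const[of _ False]])
      fix x y assume "x \<in> S" "y \<in> S"
      then have "\<not> coord x - 1 < coord y + of_int m * L"
        using coord_props[of x] coord_props[of y] multiple_ge[OF 4] L by linarith
      then show "coord x - 1 < coord y + of_int m * L \<longleftrightarrow> False" by simp
    qed
  next
    case 2
    show ?thesis
    proof (rule fo_rel_eqI)
      show "fo_rel M (\<lambda>x y w. \<not> coord y < coord x \<or> coord y < coord x \<and> coord x < coord y + 1)"
        by (intro fo_rel_disj fo_rel_not fo_rel_less' fo_rel_adjacent' fo_args)
    qed (use 2 in auto)
  next
    case 3
    show ?thesis
    proof (rule fo_rel_eqI)
      show "fo_rel M (\<lambda>x y w. coord x < coord y \<and> near x y \<and>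
          \<not> (coord x < coord y \<and> coord y < coord x + 1))"
        by (intro fo_rel_conj[OF _ fo_rel_conj] fo_rel_not fo_rel_less' fo_rel_near'
            fo_rel_adjacent' fo_args)
    next
      fix x y assume xy: "x \<in> S" "y \<in> S"
      show "coord x - 1 < coord y + of_int m * L \<longleftrightarrow> coord x < coord y \<and> near x y \<and>
          \<not> (coord x < coord y \<and> coord y < coord x + 1)"
        using near_iff[OF xy] 3 L by auto
    qed
  qed
qed

text \<open>By density, a strict inequality for the shift z + d splits at a lift of some v in S into
  one for d and one for z; k records the turns of that lift.\<close>

lemma plus_chain_iff:
  fixes z m :: int
  assumes x: "x \<in> S" and y: "y \<in> S" and d: "\<bar>d\<bar> = (1::real)"
  shows "coord x + (of_int z + d) < coord y + of_int m * L \<longleftrightarrow>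
    (\<exists>v\<in>S. \<exists>k\<in>{-1, 0, 1 :: int}. coord x + d < coord v + of_int k * L \<and>
       coord v + of_int z < coord y + of_int (m - k) * L)" (is "?l \<longleftrightarrow> ?r")
proof
  assume ?l
  \<comment> \<open>The cap coord x + d + 1 keeps the window inside three periods, so that
    \<open>dense_window\<close> applies.\<close>
  then have "coord x + d < min (coord y + of_int m * L - of_int z) (coord x + d + 1)"
    by simp
  moreover have "\<alpha> 0 - L \<le> coord x + d"
    and "min (coord y + of_int m * L - of_int z) (coord x + d + 1) \<le> \<alpha> 0 + 2 * L"
    using coord_props[OF x] d L by (auto simp: abs_if split: if_splits)
  ultimately obtain v and k :: int where "v \<in> S" "k \<in> {-1, 0, 1}" "coord x + d < coord v + of_int k * L"
    "coord v + of_int k * L < min (coord y + of_int m * L - of_int z) (coord x + d + 1)"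
    by (rule dense_window)
  then show ?r
    by (intro bexI[of _ v] bexI[of _ k]) (simp_all add: algebra_simps)
next
  assume ?r
  then obtain v and k :: int where "coord x + d < coord v + of_int k * L"
    "coord v + of_int z < coord y + of_int (m - k) * L" by blast
  then show ?l by (simp add: algebra_simps)
qed

text \<open>Induction on z from 0 in both directions, for all m at once because
  \<open>plus_chain_iff\<close> replaces m by m - k.\<close>

lemma fo_rel_plus: "fo_rel M (\<lambda>x y w. coord x + of_int z < coord y + of_int m * L)"
proof (induction z arbitrary: m rule: int_induct[of _ 0])
  case base
  consider "m \<ge> 1" | "m = 0" | "m \<le> -1" by linarith
  then show ?case
  proof cases
    case 1
    then show ?thesis
    proof (intro fo_rel_eqI[OF fo_rel_const[of _ True]])
      fix x y assume "x \<in> S" "y \<in> S"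
      then have "coord x + of_int 0 < coord y + of_int m * L"
        using coord_props[of x] coord_props[of y] multiple_ge[OF 1] by linarith
      then show "coord x + of_int 0 < coord y + of_int m * L \<longleftrightarrow> True" by simp
    qed
  next
    case 2
    then show ?thesis using fo_rel_less by simp
  next
    case 3
    then show ?thesis
    proof (intro fo_rel_eqI[OF fo_rel_const[of _ False]])
      fix x y assume "x \<in> S" "y \<in> S"
      then have "\<not> coord x + of_int 0 < coord y + of_int m * L"
        using coord_props[of x] coord_props[of y] multiple_ge[OF 3] by linarith
      then show "coord x + of_int 0 < coord y + of_int m * L \<longleftrightarrow> False" by simp
    qed
  qed
next
  case (step1 z)
  show ?case
  proof (rule fo_rel_eqI)
    have "fo_rel M (\<lambda>x y v. \<exists>k\<in>{-1, 0, 1 :: int}. coord x + 1 < coord v + of_int k * L \<and>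
       coord v + of_int z < coord y + of_int (m - k) * L)"
      by (intro fo_rel_finite_ex fo_rel_conj fo_rel_subst2[OF fo_rel_plus_one]
          fo_rel_subst2[OF step1.IH] fo_args) simp
    then show "fo_rel M (\<lambda>x y w. \<exists>v\<in>S. \<exists>k\<in>{-1, 0, 1 :: int}. coord x + 1 < coord v + of_int k * L \<and>
       coord v + of_int z < coord y + of_int (m - k) * L)"
      by (rule fo_rel_bex)
  qed (use plus_chain_iff[of _ _ 1 z m] in simp)
next
  case (step2 z)
  show ?case
  proof (rule fo_rel_eqI)
    have "fo_rel M (\<lambda>x y v. \<exists>k\<in>{-1, 0, 1 :: int}. coord x - 1 < coord v + of_int k * L \<and>
       coord v + of_int z < coord y + of_int (m - k) * L)"
      by (intro fo_rel_finite_ex fo_rel_conj fo_rel_subst2[OF fo_rel_minus_one]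
          fo_rel_subst2[OF step2.IH] fo_args) simp
    then show "fo_rel M (\<lambda>x y w. \<exists>v\<in>S. \<exists>k\<in>{-1, 0, 1 :: int}. coord x - 1 < coord v + of_int k * L \<and>
       coord v + of_int z < coord y + of_int (m - k) * L)"
      by (rule fo_rel_bex)
  qed (use plus_chain_iff[of _ _ "-1" z m] in simp)
qed

lemmas fo_rel_plus' = fo_rel_subst2[OF fo_rel_plus]

text \<open>Bounds the number of turns that have to be considered, so that finite disjunctions suffice.\<close>

lemma turns_bounded:
  fixes z t p :: int
  assumes "x \<in> S" "y \<in> S" "\<bar>coord x + of_int z - (coord y + of_int t + of_int p * L)\<bar> < L"
  shows "p \<in> {-(\<bar>z\<bar> + \<bar>t\<bar> + 2)..\<bar>z\<bar> + \<bar>t\<bar> + 2}"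
proof -
  have "\<bar>of_int p * L\<bar> < \<bar>of_int z\<bar> + \<bar>of_int t\<bar> + 2 * L"
    using assms(3) coord_props[OF assms(1)] coord_props[OF assms(2)] by linarith
  \<comment> \<open>As L \<ge> 1, the integers are bounded by multiples of L, and L can be
    cancelled.\<close>
  also have "\<dots> \<le> \<bar>of_int z\<bar> * L + \<bar>of_int t\<bar> * L + 2 * L"
    using L by (intro add_mono order_refl) (simp_all add: mult_le_cancel_left1)
  finally have "\<bar>of_int p\<bar> * L < (\<bar>of_int z\<bar> + \<bar>of_int t\<bar> + 2) * L"
    using L_pos by (simp add: abs_mult algebra_simps)
  then have "\<bar>of_int p\<bar> < (\<bar>of_int z\<bar> + \<bar>of_int t\<bar> + 2 :: real)"
    using L_pos by (simp only: mult_less_cancel_right_pos)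
  then have "\<bar>p\<bar> < \<bar>z\<bar> + \<bar>t\<bar> + 2"
    by linarith
  then show ?thesis by auto
qed

section \<open>Circular order and shifts as finite Boolean combinations\<close>

lemma shift_coord: "x \<in> S \<Longrightarrow> shift L x z = cls L (coord x + of_int z)"
  using shift_cls[of L "coord x" z] coord_props(3) by simp

lemma fo_rel_circ_order_shift: "fo_rel M (circ_order_shift L z t k)"
proof (rule fo_rel_eqI)
  let ?P = "{-(\<bar>z\<bar> + \<bar>t\<bar> + 2)..\<bar>z\<bar> + \<bar>t\<bar> + 2}" and ?Q = "{-(\<bar>z\<bar> + \<bar>k\<bar> + 2)..\<bar>z\<bar> + \<bar>k\<bar> + 2}"
  \<comment> \<open>These are the inequalities of \<open>circ_order_cls_iff\<close> for the lifts
    coord x + z, coord y + t and coord w + k, with integer shifts collected on the left.\<close>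
  let ?R = "\<lambda>p q x y w. coord x + of_int (z - t) < coord y + of_int p * L \<and>
      coord y + of_int (t - k) < coord w + of_int (q - p) * L \<and>
      coord w + of_int (k - z) < coord x + of_int (1 - q) * L"
  show "fo_rel M (\<lambda>x y w. \<exists>p\<in>?P. \<exists>q\<in>?Q. ?R p q x y w)"
    by (intro fo_rel_finite_ex fo_rel_conj fo_rel_plus' fo_args) auto
  fix x y w assume xyw: "x \<in> S" "y \<in> S" "w \<in> S"
  have "circ_order_shift L z t k x y w \<longleftrightarrow> (\<exists>p q. ?R p q x y w)"
    unfolding circ_order_shift_def shift_coord[OF xyw(1)] shift_coord[OF xyw(2)]
      shift_coord[OF xyw(3)] circ_order_cls_iff[OF L_pos]
    by (simp add: algebra_simps)
  \<comment> \<open>The chain places the lifts of the shifted y and w less than L above coord x +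
    z.\<close>
  moreover have "p \<in> ?P \<and> q \<in> ?Q" if "?R p q x y w" for p q
    using that
    by (intro conjI turns_bounded[OF xyw(1,2)] turns_bounded[OF xyw(1,3)])
      (auto simp: abs_less_iff algebra_simps)
  ultimately show "circ_order_shift L z t k x y w \<longleftrightarrow> (\<exists>p\<in>?P. \<exists>q\<in>?Q. ?R p q x y w)"
    by blast
qed

lemma fo_rel_shift: "fo_rel M (\<lambda>x y w. y = shift L x z)"
proof (rule fo_rel_eqI)
  \<comment> \<open>The range is that of \<open>turns_bounded\<close> for t = 0.\<close>
  let ?P = "{-(\<bar>z\<bar> + \<bar>0\<bar> + 2)..\<bar>z\<bar> + \<bar>0\<bar> + 2}"
  \<comment> \<open>The equation coord x + z = coord y + p L is expressed as the failure of both
    strict inequalities.\<close>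
  let ?R = "\<lambda>p x y. \<not> coord x + of_int z < coord y + of_int p * L \<and>
      \<not> coord y + of_int (- z) < coord x + of_int (- p) * L"
  show "fo_rel M (\<lambda>x y w. \<exists>p\<in>?P. ?R p x y)"
    by (intro fo_rel_finite_ex fo_rel_conj fo_rel_not fo_rel_plus' fo_args) auto
  fix x y assume xy: "x \<in> S" "y \<in> S"
  have "y = shift L x z \<longleftrightarrow> cls L (coord y) = cls L (coord x + of_int z)"
    using xy by (simp add: shift_coord coord_props)
  also have "\<dots> \<longleftrightarrow> (\<exists>p. ?R p x y)"
    unfolding cls_eq_iff by (intro arg_cong[where f = Ex]) (auto simp: fun_eq_iff)
  finally have "y = shift L x z \<longleftrightarrow> (\<exists>p. ?R p x y)" .
  moreover have "p \<in> ?P" if "?R p x y" for p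
    using that L_pos by (intro turns_bounded[OF xy]) auto
  ultimately show "y = shift L x z \<longleftrightarrow> (\<exists>p\<in>?P. ?R p x y)"
    by blast
qed

end

theorem proposition2p13:
  fixes L :: real and S :: "real set set" and a :: "nat \<Rightarrow> real set"
  assumes "L > 3"
    and "dense_in_circle L S"
    and "orienting_loop L a"
    and "\<forall>i \<le> nL L. a i \<in> S"
  shows "(\<forall>z t k :: int. definable (SL L S a) 3 (C_rel L S z t k)) \<and>
         (\<forall>z :: int. definable_pfun (SL L S a) (shift_pfun L S z))"
proof -
  obtain \<alpha> where "circle_loop L S a \<alpha>"
    using orienting_loop_lift[OF assms(1,3)] assms by (metis circle_loop.intro)
  then interpret circle_loop L S a \<alpha> .
  have "definable M 3 (C_rel L S z t k)" for z t k
    using definable_3[OF fo_rel_circ_order_shift[of z t k]] by (simp add: C_rel_def)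
  moreover have "definable_pfun M (shift_pfun L S z)" for z
  proof -
    have "{[x, y] | x y. shift_pfun L S z x = Some y} = {[x, y] | x y. x \<in> S \<and> y \<in> S \<and> y = shift L x z}"
      by (auto simp: shift_pfun_def)
    then show ?thesis
      using definable_2[OF fo_rel_shift[of z]] by (simp add: definable_pfun_def)
  qed
  ultimately show ?thesis by blast
qed

end
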